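(* For every integer $k\geq1$ there are constants $K=K(k)>0$ and $N=N(k)>0$ such that the following holds. Let $G$ be a group, $c\geq 1$, and let $A\subseteq G$ be a finite nonempty $k$-stable set with $|AA^{-1}A|\leq c|A|$. Then for every $0<\epsilon\leq\frac12$ there is a subgroup $H\leq G$ such that: (i) $H\subseteq A^{-1}A$ and $A\subseteq CH$ for some $C\subseteq A$ with $|C|\leq K(c\epsilon^{-1})^{N}$; (ii) there is a set $D\subseteq C$ such that $|A\triangle DH|<\epsilon|H|$.
   Context: A subset $A$ of a group $G$ is $k$-stable if there do not exist $a_1,\ldots,a_k,b_1,\ldots,b_k\in G$ with $a_ib_j\in A$ iff $i\leq j$. Products of sets are $XY=\{xy:x\in X,y\in Y\}$, $A^{-1}=\{a^{-1}:a\in A\}$. *)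

theory Defs
  imports Complex_Main "HOL-Algebra.Coset"
begin

definition k_stable :: "('a, 'b) monoid_scheme \<Rightarrow> nat \<Rightarrow> 'a set \<Rightarrow> bool" where
  "k_stable G k A \<longleftrightarrow>
     \<not> (\<exists>a b :: nat \<Rightarrow> 'a.
          (\<forall>i\<in>{1..k}. a i \<in> carrier G \<and> b i \<in> carrier G) \<and>
          (\<forall>i\<in>{1..k}. \<forall>j\<in>{1..k}. a i \<otimes>\<^bsub>G\<^esub> b j \<in> A \<longleftrightarrow> i \<le> j))"

text \<open>
  The constants have to depend on \<open>k\<close> alone, and be the same for the groups over all types.
  An existential quantifier inside a theorem about groups over a type variable \<open>'a\<close> would let
  them depend on \<open>'a\<close>. They are therefore introduced as global constants. No HOL formula
  quantifies over types, so they are chosen to be suitable for all groups with elements in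
  \<^typ>\<open>nat\<close>. This loses nothing: a pair suitable for those is suitable for every group, because
  the claim for a finite set \<open>A\<close> only concerns the countable subgroup generated by \<open>A\<close>.
\<close>

definition suitable_consts :: "('a, 'b) monoid_scheme \<Rightarrow> nat \<Rightarrow> real \<Rightarrow> real \<Rightarrow> bool" where
  "suitable_consts G k K N \<longleftrightarrow>
     (\<forall>(c::real) A. c \<ge> 1 \<longrightarrow> A \<subseteq> carrier G \<longrightarrow> finite A \<longrightarrow> A \<noteq> {} \<longrightarrow> k_stable G k A \<longrightarrow>
        real (card (A <#>\<^bsub>G\<^esub> set_inv\<^bsub>G\<^esub> A <#>\<^bsub>G\<^esub> A)) \<le> c * real (card A) \<longrightarrow>
        (\<forall>\<epsilon>::real. 0 < \<epsilon> \<longrightarrow> \<epsilon> \<le> 1 / 2 \<longrightarrow>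
           (\<exists>H. subgroup H G \<and> H \<subseteq> set_inv\<^bsub>G\<^esub> A <#>\<^bsub>G\<^esub> A \<and>
              (\<exists>C\<subseteq>A. A \<subseteq> C <#>\<^bsub>G\<^esub> H \<and> real (card C) \<le> K * (c * inverse \<epsilon>) powr N \<and>
                 (\<exists>D\<subseteq>C. real (card (sym_diff A (D <#>\<^bsub>G\<^esub> H))) < \<epsilon> * real (card H))))))"

definition stable_consts :: "nat \<Rightarrow> real \<times> real" where
  "stable_consts k =
     (SOME (K, N). K > 0 \<and> N > 0 \<and> (\<forall>G :: nat monoid. group G \<longrightarrow> suitable_consts G k K N))"

definition stable_K :: "nat \<Rightarrow> real" where
  "stable_K k = fst (stable_consts k)"

definition stable_N :: "nat \<Rightarrow> real" where
  "stable_N k = snd (stable_consts k)"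

end

theory Submission
  imports Defs "HOL-Algebra.Left_Coset" "HOL-Algebra.Generated_Groups" "HOL-Analysis.Convex"
    "HOL-Library.Countable_Set"
begin

text \<open>
  A \<open>k\<close>-stable \<open>A\<close> admits no tall binary tree of splittings by left translates of \<open>A\<close>. Splitting
  \<open>A\<close> as long as possible thus stops, after a number of steps bounded in terms of \<open>k\<close>, at a set
  \<open>Y \<subseteq> A\<close> of density \<open>\<eta>\<close>, polynomial in \<open>\<epsilon> / c\<close>, which every translate of \<open>A\<close> almost contains or
  almost avoids, with an error that is small even compared to \<open>\<eta>\<close>.

  Let \<open>T\<close> be the set of \<open>g\<close> such that \<open>gY\<close> is almost contained in \<open>A\<close>, and \<open>S\<close> the right
  stabiliser of \<open>T\<close>, an exact subgroup. If \<open>gS \<noteq> hS\<close>, then some translate of \<open>A\<close> separates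
  \<open>gY\<close> from \<open>hY\<close>, so these sets are almost disjoint. As they lie in \<open>A A\<inverse> A\<close> for
  \<open>g, h \<in> A A\<inverse>\<close>, at most \<open>2 c / \<eta>\<close> left cosets of \<open>S\<close> meet \<open>A A\<inverse>\<close>. Counting the pairs
  \<open>(g, y)\<close> for which \<open>gy \<in> A\<close> and \<open>g \<in> T\<close> disagree yields \<open>y \<in> Y\<close> such that \<open>A\<close> is close to
  \<open>Ty\<close>, whose right stabiliser \<open>H = y\<inverse> S y\<close> is the subgroup sought. The left cosets of \<open>H\<close>
  that make up \<open>Ty\<close> are represented in \<open>A\<close>, because each of them meets \<open>A\<close> in more than half of
  its elements; for the same reason \<open>H \<subseteq> A\<inverse> A\<close>.
\<close>

section \<open>Splitting trees and ladders\<close>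

primrec splitting_tree :: "('a \<Rightarrow> 'b \<Rightarrow> bool) \<Rightarrow> 'a set \<Rightarrow> nat \<Rightarrow> 'b set \<Rightarrow> bool" where
  "splitting_tree R S 0 Y \<longleftrightarrow> Y \<noteq> {}"
| "splitting_tree R S (Suc n) Y \<longleftrightarrow>
     (\<exists>a\<in>S. splitting_tree R S n {b \<in> Y. R a b} \<and> splitting_tree R S n {b \<in> Y. \<not> R a b})"

definition ladder :: "('a \<Rightarrow> 'b \<Rightarrow> bool) \<Rightarrow> 'a set \<Rightarrow> 'b set \<Rightarrow> nat \<Rightarrow> bool" where
  "ladder R S Y r \<longleftrightarrow>
     (\<exists>a b. (\<forall>i\<in>{1..r}. a i \<in> S) \<and> (\<forall>j\<le>r. b j \<in> Y) \<and>
        (\<forall>i\<in>{1..r}. \<forall>j\<le>r. R (a i) (b j) \<longleftrightarrow> i \<le> j))"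

lemma splitting_tree_mono:
  "splitting_tree R S n Y \<Longrightarrow> Y \<subseteq> Y' \<Longrightarrow> splitting_tree R S n Y'"
proof (induction n arbitrary: Y Y')
  case 0
  then show ?case by auto
next
  case (Suc n)
  then obtain a where a: "a \<in> S" "splitting_tree R S n {b \<in> Y. R a b}"
      "splitting_tree R S n {b \<in> Y. \<not> R a b}"
    by auto
  have "{b \<in> Y. R a b} \<subseteq> {b \<in> Y'. R a b}" "{b \<in> Y. \<not> R a b} \<subseteq> {b \<in> Y'. \<not> R a b}"
    using Suc.prems by auto
  from Suc.IH[OF a(2) this(1)] Suc.IH[OF a(3) this(2)] a(1) show ?case by auto
qed

lemma splitting_tree_nonempty: "splitting_tree R S n Y \<Longrightarrow> Y \<noteq> {}"
proof (induction n arbitrary: Y)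
  case (Suc n)
  then obtain a where "splitting_tree R S n {b \<in> Y. R a b}" by auto
  from Suc.IH[OF this] show ?case by blast
qed simp

lemma splitting_tree_Un:
  "splitting_tree R (S \<union> T) (n + m) Y \<Longrightarrow> splitting_tree R S n Y \<or> splitting_tree R T m Y"
proof (induction "n + m" arbitrary: S T n m Y)
  case 0
  then show ?case by simp
next
  case (Suc l)
  have "Y \<noteq> {}" using Suc.prems by (rule splitting_tree_nonempty)
  have "splitting_tree R (S \<union> T) (Suc l) Y" using Suc.prems Suc.hyps(2) by simp
  then obtain a where "a \<in> S \<union> T" and
    children: "splitting_tree R (S \<union> T) l {b \<in> Y. R a b}"
      "splitting_tree R (S \<union> T) l {b \<in> Y. \<not> R a b}"
    by auto
  have root: "splitting_tree R S' n' Y \<or> splitting_tree R T' m' Y"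
    if "a \<in> S'" "S' \<union> T' = S \<union> T" "n' + m' = Suc l" for S' T' n' m'
  proof (cases n')
    case 0
    with \<open>Y \<noteq> {}\<close> show ?thesis by simp
  next
    case (Suc i)
    have "splitting_tree R S' i Z \<or> splitting_tree R T' m' Y"
      if "splitting_tree R (S \<union> T) l Z" "Z \<subseteq> Y" for Z
    proof -
      have "l = i + m'" using \<open>n' + m' = Suc l\<close> Suc by simp
      from Suc.hyps(1)[OF this, of S' T' Z] show ?thesis
        using that \<open>S' \<union> T' = S \<union> T\<close> \<open>l = i + m'\<close>
          splitting_tree_mono[OF _ \<open>Z \<subseteq> Y\<close>, of R T' m'] by auto
    qed
    from this[OF children(1)] this[OF children(2)] show ?thesis
      using \<open>a \<in> S'\<close> Suc by auto
  qed
  from \<open>a \<in> S \<union> T\<close> show ?case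
    using root[of S T n m] root[of T S m n] Suc.hyps(2) by (auto simp: Un_commute add.commute)
qed

lemma ladder_complement:
  assumes "ladder (\<lambda>a b. \<not> R a b) S Y r"
  shows "ladder R S Y r"
proof -
  obtain a b where ab: "\<forall>i\<in>{1..r}. a i \<in> S" "\<forall>j\<le>r. b j \<in> Y"
    "\<forall>i\<in>{1..r}. \<forall>j\<le>r. \<not> R (a i) (b j) \<longleftrightarrow> i \<le> j"
    using assms unfolding ladder_def by blast
  have reflect: "Suc r - i \<in> {1..r}" if "i \<in> {1..r}" for i using that by auto
  have "R (a (Suc r - i)) (b (r - j)) \<longleftrightarrow> i \<le> j" if "i \<in> {1..r}" "j \<le> r" for i j
  proof -
    have "r - j \<le> r" by simp
    with ab(3) reflect[OF that(1)]
    have "R (a (Suc r - i)) (b (r - j)) \<longleftrightarrow> \<not> Suc r - i \<le> r - j" by blast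
    also have "\<dots> \<longleftrightarrow> i \<le> j" using that by auto
    finally show ?thesis .
  qed
  moreover have "\<forall>i\<in>{1..r}. a (Suc r - i) \<in> S" using ab(1) reflect by blast
  moreover have "\<forall>j\<le>r. b (r - j) \<in> Y" using ab(2) by simp
  ultimately show ?thesis
    unfolding ladder_def
    by (intro exI[of _ "\<lambda>i. a (Suc r - i)"] exI[of _ "\<lambda>j. b (r - j)"] conjI ballI allI impI)
      simp_all
qed

lemma ladder_extend_last:
  assumes "ladder R S' Y' r" "S' \<subseteq> S" "Y' \<subseteq> Y" "a \<in> S'" "b \<in> Y"
    and "\<And>x. x \<in> S' \<Longrightarrow> R x b" "\<And>z. z \<in> Y' \<Longrightarrow> \<not> R a z"
  shows "ladder R S Y (Suc r)"
proof -
  obtain f g where fg: "\<And>i. i \<in> {1..r} \<Longrightarrow> f i \<in> S'" "\<And>j. j \<le> r \<Longrightarrow> g j \<in> Y'"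
    "\<And>i j. i \<in> {1..r} \<Longrightarrow> j \<le> r \<Longrightarrow> R (f i) (g j) \<longleftrightarrow> i \<le> j"
    using assms(1) unfolding ladder_def by (elim exE conjE) blast
  define f' where "f' = f(Suc r := a)"
  define g' where "g' = g(Suc r := b)"
  have f': "f' i = a \<and> i = Suc r \<or> i \<in> {1..r} \<and> f' i = f i" if "i \<in> {1..Suc r}" for i
    using that by (auto simp: f'_def)
  have g': "g' j = b \<and> j = Suc r \<or> j \<le> r \<and> g' j = g j" if "j \<le> Suc r" for j
    using that by (auto simp: g'_def)
  show ?thesis
    unfolding ladder_def
  proof (intro exI[of _ f'] exI[of _ g'] conjI ballI allI impI)
    fix i assume "i \<in> {1..Suc r}"
    from f'[OF this] fg(1)[of i] assms(2,4) show "f' i \<in> S" by auto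
  next
    fix j assume "j \<le> Suc r"
    from g'[OF this] fg(2)[of j] assms(3,5) show "g' j \<in> Y" by auto
  next
    fix i j assume "i \<in> {1..Suc r}" "j \<le> Suc r"
    from f'[OF this(1)] g'[OF this(2)] show "R (f' i) (g' j) \<longleftrightarrow> i \<le> j"
      by (elim disjE conjE) (use fg(1,3) assms(4,6) fg(2)[THEN assms(7)] in auto)
  qed
qed

lemma ladder_extend_first:
  assumes "ladder R S' Y' r" "S' \<subseteq> S" "Y' \<subseteq> Y" "a \<in> S'" "b \<in> Y"
    and "\<And>x. x \<in> S' \<Longrightarrow> \<not> R x b" "\<And>z. z \<in> Y' \<Longrightarrow> R a z"
  shows "ladder R S Y (Suc r)"
proof -
  have "ladder (\<lambda>a b. \<not> R a b) S' Y' r"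
    by (rule ladder_complement) (use assms(1) in simp)
  then have "ladder (\<lambda>a b. \<not> R a b) S Y (Suc r)"
    by (rule ladder_extend_last) (use assms in auto)
  then show ?thesis by (rule ladder_complement)
qed

text \<open>
  Pick a leaf \<open>b\<close>. Half of the height survives on the nodes \<open>a\<close> on whose relation to \<open>b\<close> all
  agree; the root of what is left, together with \<open>b\<close>, extends at one of its two ends a ladder
  found in a child of that root.
\<close>

lemma ladder_of_splitting_tree:
  "splitting_tree R S (2 ^ Suc r - 2) Y \<Longrightarrow> ladder R S Y r"
proof (induction r arbitrary: S Y)
  case 0
  then obtain z where "z \<in> Y" by auto
  then show ?case unfolding ladder_def by (intro exI[of _ "\<lambda>_. z"] exI) auto
next
  case (Suc r)
  define h :: nat where "h = 2 ^ Suc r - 2"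
  have "(2::nat) ^ r \<ge> 1" by simp
  then have height: "2 ^ Suc (Suc r) - 2 = Suc h + Suc h"
    unfolding h_def power_Suc by linarith
  from Suc.prems obtain b where "b \<in> Y" using splitting_tree_nonempty by blast
  have "{a \<in> S. R a b} \<union> {a \<in> S. \<not> R a b} = S" by auto
  with Suc.prems have "splitting_tree R ({a \<in> S. R a b} \<union> {a \<in> S. \<not> R a b}) (Suc h + Suc h) Y"
    by (simp only: height)
  then consider (related) "splitting_tree R {a \<in> S. R a b} (Suc h) Y"
    | (unrelated) "splitting_tree R {a \<in> S. \<not> R a b} (Suc h) Y"
    using splitting_tree_Un by blast
  then show ?case
  proof cases
    case related
    then obtain a where "a \<in> {a \<in> S. R a b}"
      and below: "splitting_tree R {a \<in> S. R a b} h {z \<in> Y. \<not> R a z}"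
      by auto
    with Suc.IH[OF below[unfolded h_def]] \<open>b \<in> Y\<close> show ?thesis
      by (intro ladder_extend_last[where a = a and b = b]) auto
  next
    case unrelated
    then obtain a where "a \<in> {a \<in> S. \<not> R a b}"
      and below: "splitting_tree R {a \<in> S. \<not> R a b} h {z \<in> Y. R a z}"
      by auto
    with Suc.IH[OF below[unfolded h_def]] \<open>b \<in> Y\<close> show ?thesis
      by (intro ladder_extend_first[where a = a and b = b]) auto
  qed
qed

abbreviation (input) product_in :: "('a, 'b) monoid_scheme \<Rightarrow> 'a set \<Rightarrow> 'a \<Rightarrow> 'a \<Rightarrow> bool" where
  "product_in G A \<equiv> \<lambda>x y. x \<otimes>\<^bsub>G\<^esub> y \<in> A"

lemma not_k_stableI:
  fixes a b :: "nat \<Rightarrow> 'a" and G :: "('a, 'b) monoid_scheme"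
  assumes "\<And>i. i \<in> {1..k} \<Longrightarrow> a i \<in> carrier G" "\<And>j. j \<in> {1..k} \<Longrightarrow> b j \<in> carrier G"
    and "\<And>i j. i \<in> {1..k} \<Longrightarrow> j \<in> {1..k} \<Longrightarrow> a i \<otimes>\<^bsub>G\<^esub> b j \<in> A \<longleftrightarrow> i \<le> j"
  shows "\<not> k_stable G k A"
  unfolding k_stable_def not_not
proof (intro exI conjI ballI)
  show "a i \<in> carrier G" "b i \<in> carrier G" if "i \<in> {1..k}" for i using assms(1,2) that by auto
  show "a i \<otimes>\<^bsub>G\<^esub> b j \<in> A \<longleftrightarrow> i \<le> j" if "i \<in> {1..k}" "j \<in> {1..k}" for i j
    using that by (rule assms(3))
qed

lemma k_stable_no_ladder:
  assumes "k_stable G k A"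
  shows "\<not> ladder (product_in G A) (carrier G) (carrier G) k"
proof
  assume "ladder (product_in G A) (carrier G) (carrier G) k"
  then obtain a b where "\<forall>i\<in>{1..k}. a i \<in> carrier G" "\<forall>j\<le>k. b j \<in> carrier G"
      "\<forall>i\<in>{1..k}. \<forall>j\<le>k. a i \<otimes>\<^bsub>G\<^esub> b j \<in> A \<longleftrightarrow> i \<le> j"
    unfolding ladder_def by blast
  then have "\<not> k_stable G k A" by (intro not_k_stableI[of k a G b]) auto
  with assms show False by contradiction
qed

section \<open>Homogeneous sets\<close>

definition homogeneous :: "('a \<Rightarrow> 'b \<Rightarrow> bool) \<Rightarrow> 'a set \<Rightarrow> real \<Rightarrow> 'b set \<Rightarrow> bool" where
  "homogeneous R S \<delta> Y \<longleftrightarrow>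
     (\<forall>a\<in>S. real (card {b \<in> Y. R a b}) \<le> \<delta> * real (card Y) \<or>
        real (card {b \<in> Y. \<not> R a b}) \<le> \<delta> * real (card Y))"

lemma not_homogeneous_imp_subset_shorter_tree:
  assumes "\<not> homogeneous R S \<delta> Y" "\<not> splitting_tree R S (Suc n) Y"
  obtains Z where "Z \<subseteq> Y" "\<delta> * card Y < card Z" "\<not> splitting_tree R S n Z"
proof -
  obtain a where "a \<in> S" "\<delta> * card Y < card {b \<in> Y. R a b}"
      "\<delta> * card Y < card {b \<in> Y. \<not> R a b}"
    using assms(1) unfolding homogeneous_def by force
  moreover have "\<not> splitting_tree R S n {b \<in> Y. R a b} \<or> \<not> splitting_tree R S n {b \<in> Y. \<not> R a b}"
    using assms(2) \<open>a \<in> S\<close> by auto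
  ultimately show thesis
    using that[of "{b \<in> Y. R a b}"] that[of "{b \<in> Y. \<not> R a b}"] by auto
qed

text \<open>
  The homogeneity \<open>r * \<eta>\<close> asked for is proportional to the density \<open>\<eta>\<close> reached so far. A split
  therefore replaces \<open>\<eta>\<close> by \<open>r * \<eta>\<^sup>2\<close>, and a bounded number of splits costs only a power of \<open>r\<close>.
\<close>

lemma homogeneous_subset_of_density:
  fixes r \<eta> M :: real
  assumes "\<not> splitting_tree R S n Y" "0 < r" "r \<le> 1" "0 < \<eta>" "\<eta> \<le> 1" "0 < M" "\<eta> * M \<le> card Y"
  shows "\<exists>Z \<theta>. Z \<subseteq> Y \<and> (r * \<eta>) ^ 2 ^ n \<le> \<theta> \<and> \<theta> \<le> 1 \<and> \<theta> * M \<le> card Z \<and>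
           homogeneous R S (r * \<theta>) Z"
  using assms
proof (induction n arbitrary: Y \<eta>)
  case 0
  then have "0 < \<eta> * M" by simp
  with 0 show ?case by simp
next
  case (Suc n)
  have r\<eta>: "0 < r * \<eta>" "r * \<eta> \<le> \<eta>" "r * \<eta> \<le> 1"
    using Suc.prems by (auto simp: mult_le_one mult_le_cancel_right1)
  show ?case
  proof (cases "homogeneous R S (r * \<eta>) Y")
    case True
    from r\<eta> have "(r * \<eta>) ^ 2 ^ Suc n \<le> (r * \<eta>) ^ 1"
      by (intro power_decreasing) auto
    with r\<eta> have "(r * \<eta>) ^ 2 ^ Suc n \<le> \<eta>" by simp
    with True Suc.prems show ?thesis by blast
  next
    case False
    define \<xi> where "\<xi> = r * \<eta> * \<eta>"
    have \<xi>: "0 < \<xi>" "\<xi> \<le> 1" unfolding \<xi>_def using Suc.prems r\<eta> by (auto simp: mult_le_one)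
    obtain Z where Z: "Z \<subseteq> Y" "r * \<eta> * card Y < card Z" "\<not> splitting_tree R S n Z"
      using not_homogeneous_imp_subset_shorter_tree[OF False Suc.prems(1)] .
    have "\<xi> * M = r * \<eta> * (\<eta> * M)" by (simp add: \<xi>_def mult.assoc)
    also have "\<dots> \<le> r * \<eta> * card Y" using r\<eta>(1) Suc.prems by (intro mult_left_mono) auto
    finally have "\<xi> * M \<le> card Z" using Z(2) by linarith
    from Suc.IH[OF Z(3) Suc.prems(2,3) \<xi> Suc.prems(6) this]
    obtain W \<theta> where W: "W \<subseteq> Z" "(r * \<xi>) ^ 2 ^ n \<le> \<theta>" "\<theta> \<le> 1" "\<theta> * M \<le> card W"
      "homogeneous R S (r * \<theta>) W"
      by blast
    have "r * \<xi> = (r * \<eta>) ^ 2" by (simp add: \<xi>_def power2_eq_square mult_ac)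
    then have "(r * \<xi>) ^ 2 ^ n = (r * \<eta>) ^ 2 ^ Suc n" by (simp flip: power_mult)
    with W Z(1) show ?thesis by (metis subset_trans)
  qed
qed

lemma exists_homogeneous_subset:
  fixes r :: real
  assumes "\<not> splitting_tree R S n X" "0 < r" "r \<le> 1" "finite X" "X \<noteq> {}"
  obtains Y \<eta> where "Y \<subseteq> X" "Y \<noteq> {}" "r ^ 2 ^ n \<le> \<eta>" "\<eta> \<le> 1" "\<eta> * card X \<le> card Y"
    "homogeneous R S (r * \<eta>) Y"
proof -
  have "0 < real (card X)" using assms by (simp add: card_gt_0_iff)
  from homogeneous_subset_of_density[OF assms(1-3) _ _ this, of 1]
  obtain Y \<eta> where Y: "Y \<subseteq> X" "r ^ 2 ^ n \<le> \<eta>" "\<eta> \<le> 1" "\<eta> * card X \<le> card Y"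
    "homogeneous R S (r * \<eta>) Y"
    by auto
  have "0 < r ^ 2 ^ n" using assms(2) by simp
  also note Y(2)
  finally have "0 < \<eta> * card X" using \<open>0 < real (card X)\<close> by simp
  with Y(4) have "Y \<noteq> {}" by auto
  with Y that show thesis by blast
qed

section \<open>Double counting\<close>

lemma sum_card_squared_le:
  assumes "finite I" "finite U" "\<And>i. i \<in> I \<Longrightarrow> B i \<subseteq> U"
  shows "(\<Sum>i\<in>I. real (card (B i)))\<^sup>2 \<le>
           real (card U) * (\<Sum>i\<in>I. \<Sum>j\<in>I. real (card (B i \<inter> B j)))"
proof -
  define d where "d u = card {i \<in> I. u \<in> B i}" for u
  have "{u \<in> U. u \<in> B i} = B i" if "i \<in> I" for i using assms(3)[OF that] by auto
  then have "(\<Sum>i\<in>I. card (B i)) = (\<Sum>i\<in>I. card {u \<in> U. u \<in> B i})" by simp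
  also have "\<dots> = (\<Sum>u\<in>U. d u)"
    unfolding d_def using assms(1,2) by (intro sum_multicount_gen) auto
  finally have cards: "(\<Sum>i\<in>I. real (card (B i))) = (\<Sum>u\<in>U. real (d u))"
    by (metis of_nat_sum)
  have "(\<Sum>i\<in>I. \<Sum>j\<in>I. card (B i \<inter> B j)) = (\<Sum>p\<in>I \<times> I. card (B (fst p) \<inter> B (snd p)))"
    by (simp add: sum.cartesian_product split_def)
  also have "\<dots> = (\<Sum>p\<in>I \<times> I. card {u \<in> U. u \<in> B (fst p) \<inter> B (snd p)})"
    using assms(3) by (intro sum.cong refl arg_cong[where f = card]) fastforce
  also have "\<dots> = (\<Sum>u\<in>U. (d u)\<^sup>2)"
  proof (rule sum_multicount_gen)
    have "{p \<in> I \<times> I. u \<in> B (fst p) \<inter> B (snd p)} = {i \<in> I. u \<in> B i} \<times> {i \<in> I. u \<in> B i}" for u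
      by auto
    then show "\<forall>u\<in>U. card {p \<in> I \<times> I. u \<in> B (fst p) \<inter> B (snd p)} = (d u)\<^sup>2"
      by (simp add: d_def card_cartesian_product power2_eq_square)
  qed (use assms(1,2) in auto)
  finally have pairs: "(\<Sum>i\<in>I. \<Sum>j\<in>I. real (card (B i \<inter> B j))) = (\<Sum>u\<in>U. (real (d u))\<^sup>2)"
    by (metis (mono_tags, lifting) of_nat_power of_nat_sum sum.cong)
  show ?thesis
    unfolding cards pairs using sum_squared_le_sum_of_squares[of "\<lambda>u. real (d u)" U]
    by (simp add: mult.commute)
qed

lemma card_almost_disjoint_family_le:
  fixes L s t :: real
  assumes fin: "finite I" "finite U" and sub: "\<And>i. i \<in> I \<Longrightarrow> B i \<subseteq> U"
    and size: "\<And>i. i \<in> I \<Longrightarrow> card (B i) = s" "0 < s"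
    and overlap: "\<And>i j. i \<in> I \<Longrightarrow> j \<in> I \<Longrightarrow> i \<noteq> j \<Longrightarrow> card (B i \<inter> B j) \<le> t" "0 \<le> t"
    and bounds: "card U \<le> L * s" "L * t \<le> s / 2" "0 \<le> L"
  shows "card I \<le> 2 * L"
proof -
  define m where "m = real (card I)"
  have row: "(\<Sum>j\<in>I. real (card (B i \<inter> B j))) \<le> s + m * t" if "i \<in> I" for i
  proof -
    have "(\<Sum>j\<in>I. real (card (B i \<inter> B j)))
        = real (card (B i \<inter> B i)) + (\<Sum>j\<in>I - {i}. real (card (B i \<inter> B j)))"
      using fin(1) that by (rule sum.remove)
    also have "\<dots> \<le> s + card (I - {i}) * t"
      using size(1) overlap(1) that by (intro add_mono sum_bounded_above) auto
    also have "\<dots> \<le> s + m * t"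
      unfolding m_def using fin(1) overlap(2)
      by (intro add_left_mono mult_right_mono) (auto simp: card_mono)
    finally show ?thesis .
  qed
  have "(m * s)\<^sup>2 = (\<Sum>i\<in>I. real (card (B i)))\<^sup>2" using size(1) by (simp add: m_def)
  also have "\<dots> \<le> card U * (\<Sum>i\<in>I. \<Sum>j\<in>I. real (card (B i \<inter> B j)))"
    using fin sub by (rule sum_card_squared_le)
  also have "\<dots> \<le> (L * s) * (m * (s + m * t))"
    unfolding m_def using size(2) bounds(1,3) row[unfolded m_def]
    by (intro mult_mono sum_bounded_above) (auto intro!: sum_nonneg)
  also have "\<dots> = m * s * (L * s + m * (L * t))" by (simp add: algebra_simps)
  also have "\<dots> \<le> m * s * (L * s + m * (s / 2))"
    using size(2) bounds(2) by (intro mult_left_mono add_left_mono) (auto simp: m_def)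
  finally have "m * (m * s\<^sup>2) \<le> m * (L * s\<^sup>2 + m * s\<^sup>2 / 2)"
    by (simp add: algebra_simps power2_eq_square)
  then have "m = 0 \<or> m * s\<^sup>2 \<le> (2 * L) * s\<^sup>2"
    by (auto simp: mult_le_cancel_left m_def)
  with size(2) bounds(3) show ?thesis by (auto simp: m_def)
qed

lemma exists_fibre_card_le_average:
  fixes \<delta> :: real
  assumes "finite U" "finite Y" "Y \<noteq> {}"
    and "\<And>g. g \<in> U \<Longrightarrow> card {y \<in> Y. E g y} \<le> \<delta> * card Y"
  obtains y where "y \<in> Y" "card {g \<in> U. E g y} \<le> \<delta> * card U"
proof -
  have "\<exists>y\<in>Y. card {g \<in> U. E g y} \<le> \<delta> * card U"
  proof (rule ccontr)
    assume "\<not> ?thesis"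
    then have "\<delta> * card U < card {g \<in> U. E g y}" if "y \<in> Y" for y using that by force
    then have "(\<Sum>y\<in>Y. \<delta> * card U) < (\<Sum>y\<in>Y. real (card {g \<in> U. E g y}))"
      using assms by (intro sum_strict_mono) auto
    also have "\<dots> = real (\<Sum>y\<in>Y. card {g \<in> U. E g y})" by simp
    also have "(\<Sum>y\<in>Y. card {g \<in> U. E g y}) = (\<Sum>g\<in>U. card {y \<in> Y. E g y})"
      using assms(1,2) by (intro sum_multicount_gen) auto
    also have "real \<dots> = (\<Sum>g\<in>U. real (card {y \<in> Y. E g y}))" by simp
    also have "\<dots> \<le> card U * (\<delta> * card Y)" using assms(4) by (intro sum_bounded_above)
    finally show False by (simp add: mult_ac)
  qed
  then show thesis using that by blast
qed

section \<open>Left cosets\<close>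

lemma l_coset_eq_image: "x <#\<^bsub>G\<^esub> Y = (\<lambda>y. x \<otimes>\<^bsub>G\<^esub> y) ` Y"
  by (auto simp: l_coset_def)

lemma r_coset_eq_image: "Y #>\<^bsub>G\<^esub> x = (\<lambda>y. y \<otimes>\<^bsub>G\<^esub> x) ` Y"
  by (auto simp: r_coset_def)

lemma set_mult_eq_image: "X <#>\<^bsub>G\<^esub> Y = (\<lambda>(x, y). x \<otimes>\<^bsub>G\<^esub> y) ` (X \<times> Y)"
  by (auto simp: set_mult_def)

lemma finite_set_mult: "finite X \<Longrightarrow> finite Y \<Longrightarrow> finite (X <#>\<^bsub>G\<^esub> Y)"
  by (simp add: set_mult_eq_image)

lemma card_set_mult_le:
  assumes "finite X" "finite Y"
  shows "card (X <#>\<^bsub>G\<^esub> Y) \<le> card X * card Y"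
  unfolding set_mult_eq_image card_cartesian_product[symmetric]
  using assms by (intro card_image_le) simp

lemma finite_set_inv: "finite X \<Longrightarrow> finite (set_inv\<^bsub>G\<^esub> X)"
  by (simp add: SET_INV_def)

context group
begin

lemma set_inv_closed: "X \<subseteq> carrier G \<Longrightarrow> set_inv X \<subseteq> carrier G"
  by (auto simp: SET_INV_def)

lemma mult_inv_mem_set_mult: "x \<in> X \<Longrightarrow> y \<in> Y \<Longrightarrow> x \<otimes> inv y \<in> X <#> set_inv Y"
  unfolding set_mult_def SET_INV_def by blast

lemma card_l_coset: "x \<in> carrier G \<Longrightarrow> Y \<subseteq> carrier G \<Longrightarrow> card (x <# Y) = card Y"
  unfolding l_coset_eq_image by (intro card_image inj_on_subset[OF inj_on_cmult])

lemma card_r_coset: "x \<in> carrier G \<Longrightarrow> Y \<subseteq> carrier G \<Longrightarrow> card (Y #> x) = card Y"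
  unfolding r_coset_eq_image by (intro card_image inj_on_subset[OF inj_on_multc])

lemma mem_l_coset_iff:
  assumes "x \<in> carrier G" "z \<in> carrier G" "Y \<subseteq> carrier G"
  shows "z \<in> x <# Y \<longleftrightarrow> inv x \<otimes> z \<in> Y"
proof
  assume "z \<in> x <# Y"
  then obtain y where "y \<in> Y" "z = x \<otimes> y" by (auto simp: l_coset_eq_image)
  with assms show "inv x \<otimes> z \<in> Y" by (simp add: subset_iff flip: m_assoc)
next
  assume "inv x \<otimes> z \<in> Y"
  moreover have "z = x \<otimes> (inv x \<otimes> z)" using assms(1,2) by (simp flip: m_assoc)
  ultimately show "z \<in> x <# Y" unfolding l_coset_eq_image by blast
qed

lemma mem_r_coset_iff:
  assumes "x \<in> carrier G" "z \<in> carrier G" "Y \<subseteq> carrier G"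
  shows "z \<in> Y #> x \<longleftrightarrow> z \<otimes> inv x \<in> Y"
proof
  assume "z \<in> Y #> x"
  then obtain y where "y \<in> Y" "z = y \<otimes> x" by (auto simp: r_coset_eq_image)
  with assms show "z \<otimes> inv x \<in> Y" by (simp add: m_assoc subset_iff)
next
  assume "z \<otimes> inv x \<in> Y"
  moreover have "z = z \<otimes> inv x \<otimes> x" using assms(1,2) by (simp add: m_assoc)
  ultimately show "z \<in> Y #> x" unfolding r_coset_eq_image by blast
qed

lemma subset_r_coset_quotient_set:
  assumes "A \<subseteq> carrier G" "y \<in> A"
  shows "A \<subseteq> (A <#> set_inv A) #> y"
proof
  fix a assume "a \<in> A"
  then have "a \<otimes> inv y \<in> A <#> set_inv A" using assms(2) by (rule mult_inv_mem_set_mult)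
  moreover have "A <#> set_inv A \<subseteq> carrier G"
    using assms(1) by (intro set_mult_closed set_inv_closed)
  ultimately show "a \<in> (A <#> set_inv A) #> y"
    using \<open>a \<in> A\<close> assms by (subst mem_r_coset_iff) auto
qed

lemma l_coset_eq_iff:
  assumes "subgroup H G" "x \<in> carrier G" "y \<in> carrier G"
  shows "x <# H = y <# H \<longleftrightarrow> inv x \<otimes> y \<in> H"
proof
  assume "x <# H = y <# H"
  then have "y \<in> x <# H" using lcos_self[OF assms(3,1)] by simp
  then show "inv x \<otimes> y \<in> H"
    using assms(2,3) subgroup.subset[OF assms(1)] by (simp add: mem_l_coset_iff)
next
  assume "inv x \<otimes> y \<in> H"
  then have "y \<in> x <# H"
    using assms(2,3) subgroup.subset[OF assms(1)] by (simp add: mem_l_coset_iff)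
  then show "x <# H = y <# H" using assms(2,1) by (rule l_repr_independence)
qed

lemma exists_left_transversal:
  assumes "subgroup H G" "X \<subseteq> carrier G"
  obtains C where "C \<subseteq> X" "X \<subseteq> C <#> H" "inj_on (\<lambda>x. x <# H) C"
    "card C = card ((\<lambda>x. x <# H) ` X)"
proof -
  obtain C where C: "C \<subseteq> X" "inj_on (\<lambda>x. x <# H) C" "(\<lambda>x. x <# H) ` X = (\<lambda>x. x <# H) ` C"
    using iffD1[OF subset_image_inj order_refl] by metis
  have "x \<in> C <#> H" if "x \<in> X" for x
  proof -
    obtain c where "c \<in> C" "x <# H = c <# H" using C(3) \<open>x \<in> X\<close> by blast
    then have "x \<in> c <# H" using lcos_self assms \<open>x \<in> X\<close> by blast
    with \<open>c \<in> C\<close> show ?thesis by (auto simp: l_coset_def set_mult_def)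
  qed
  then have "X \<subseteq> C <#> H" by blast
  from that[OF C(1) this C(2)] C(2,3) show thesis by (simp add: card_image)
qed

lemma card_le_card_left_cosets_mult:
  assumes "subgroup H G" "finite H" "X \<subseteq> carrier G" "finite X"
  shows "card X \<le> card ((\<lambda>x. x <# H) ` X) * card H"
proof -
  obtain C where C: "C \<subseteq> X" "X \<subseteq> C <#> H" "card C = card ((\<lambda>x. x <# H) ` X)"
    using exists_left_transversal[OF assms(1,3)] .
  have "finite C" using C(1) assms(4) by (rule finite_subset)
  have "card X \<le> card (C <#> H)"
    using C(2) \<open>finite C\<close> assms(2) by (intro card_mono finite_set_mult)
  also have "\<dots> \<le> card C * card H" using \<open>finite C\<close> assms(2) by (rule card_set_mult_le)
  finally show ?thesis using C(3) by simp
qed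

lemma l_coset_subset_of_set_mult_subset:
  "P <#> H \<subseteq> P \<Longrightarrow> p \<in> P \<Longrightarrow> p <# H \<subseteq> P"
  by (auto simp: l_coset_def set_mult_def)

lemma finite_subgroup_of_invariant_set:
  assumes "subgroup H G" "P \<subseteq> carrier G" "finite P" "P \<noteq> {}" "P <#> H \<subseteq> P"
  shows "finite H"
proof -
  obtain p where "p \<in> P" using assms(4) by blast
  then have "finite ((\<lambda>h. p \<otimes> h) ` H)"
    using l_coset_subset_of_set_mult_subset[OF assms(5)] assms(3) finite_subset
    unfolding l_coset_eq_image by blast
  moreover have "inj_on (\<lambda>h. p \<otimes> h) H"
    using \<open>p \<in> P\<close> assms(2) subgroup.subset[OF assms(1)] by (intro inj_on_g') auto
  ultimately show ?thesis by (rule finite_imageD)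
qed

text \<open>
  If \<open>T\<close> is the part of \<open>pH\<close> in \<open>A\<close>, then \<open>T\<close> and \<open>Th\<close> both fill more than half of \<open>pH\<close>, so they
  meet.
\<close>

lemma subgroup_subset_set_inv_mult:
  assumes "subgroup H G" "finite H" "p \<in> carrier G" "2 * card ((p <# H) - A) < card H"
  shows "H \<subseteq> set_inv A <#> A"
proof
  fix h assume "h \<in> H"
  interpret H: subgroup H G by fact
  define T where "T = (p <# H) \<inter> A"
  have coset: "p <# H \<subseteq> carrier G" "finite (p <# H)" "card (p <# H) = card H"
    using assms l_coset_subset_G[OF H.subset] card_l_coset[OF _ H.subset]
    by (auto simp: l_coset_eq_image)
  have "h \<in> carrier G" using \<open>h \<in> H\<close> by simp
  have "T \<subseteq> carrier G" using coset(1) by (auto simp: T_def)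
  have "T #> h \<subseteq> p <# H"
    using \<open>h \<in> H\<close> assms(3) by (auto simp: T_def l_coset_eq_image r_coset_eq_image m_assoc)
  have "T \<inter> (T #> h) \<noteq> {}"
  proof
    assume "T \<inter> (T #> h) = {}"
    have "card T + card ((p <# H) - A) = card H"
      using coset card_Int_Diff[of "p <# H" A] by (simp add: T_def)
    then have "card H < card T + card (T #> h)"
      using card_r_coset[OF \<open>h \<in> carrier G\<close> \<open>T \<subseteq> carrier G\<close>] assms(4) by linarith
    also have "\<dots> = card (T \<union> (T #> h))"
      using \<open>T \<inter> (T #> h) = {}\<close> coset(2) \<open>T #> h \<subseteq> p <# H\<close>
      by (intro card_Un_disjoint[symmetric]) (auto simp: T_def intro: finite_subset)
    also have "\<dots> \<le> card (p <# H)"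
      using coset(2) \<open>T #> h \<subseteq> p <# H\<close> by (intro card_mono) (auto simp: T_def)
    finally show False using coset(3) by simp
  qed
  then obtain t where "t \<in> T" "t \<otimes> h \<in> T" by (auto simp: r_coset_eq_image)
  moreover have "h = inv t \<otimes> (t \<otimes> h)"
    using \<open>t \<in> T\<close> \<open>T \<subseteq> carrier G\<close> \<open>h \<in> carrier G\<close> by (simp add: subset_iff flip: m_assoc)
  ultimately show "h \<in> set_inv A <#> A"
    unfolding set_mult_def SET_INV_def T_def by auto
qed

lemma set_mult_representatives_of_invariant_set:
  assumes "subgroup H G" "P \<subseteq> carrier G" "P <#> H \<subseteq> P" "C \<subseteq> carrier G" "A \<subseteq> C <#> H"
    and meets: "\<And>p. p \<in> P \<Longrightarrow> (p <# H) \<inter> A \<noteq> {}"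
  shows "(C \<inter> P) <#> H = P"
proof
  show "(C \<inter> P) <#> H \<subseteq> P" using assms(3) by (auto simp: set_mult_def)
  show "P \<subseteq> (C \<inter> P) <#> H"
  proof
    fix p assume "p \<in> P"
    then have "p \<in> carrier G" using assms(2) by blast
    obtain a where "a \<in> p <# H" "a \<in> A" using meets[OF \<open>p \<in> P\<close>] by blast
    then obtain c where "c \<in> C" "a \<in> c <# H"
      using assms(5) by (auto simp: set_mult_def l_coset_def)
    have "c \<in> carrier G" using \<open>c \<in> C\<close> assms(4) by blast
    have "p <# H = a <# H"
      using \<open>a \<in> p <# H\<close> \<open>p \<in> carrier G\<close> assms(1) by (rule l_repr_independence)
    also have "\<dots> = c <# H"
      using \<open>a \<in> c <# H\<close> \<open>c \<in> carrier G\<close> assms(1) by (rule l_repr_independence[symmetric])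
    finally have "p <# H = c <# H" .
    then have "c \<in> p <# H" "p \<in> c <# H"
      using lcos_self[OF \<open>c \<in> carrier G\<close> assms(1)] lcos_self[OF \<open>p \<in> carrier G\<close> assms(1)] by auto
    then have "c \<in> P" using l_coset_subset_of_set_mult_subset[OF assms(3) \<open>p \<in> P\<close>] by blast
    with \<open>c \<in> C\<close> \<open>p \<in> c <# H\<close> show "p \<in> (C \<inter> P) <#> H"
      by (auto simp: l_coset_def set_mult_def)
  qed
qed

lemma coset_union_near_invariant_set:
  assumes "subgroup H G" "A \<subseteq> carrier G" "finite A"
    and P: "P \<subseteq> carrier G" "finite P" "P \<noteq> {}" "P <#> H \<subseteq> P"
    and close: "2 * card (sym_diff A P) < card H"
  obtains C D where "H \<subseteq> set_inv A <#> A" "C \<subseteq> A" "A \<subseteq> C <#> H"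
    "card C = card ((\<lambda>a. a <# H) ` A)" "D \<subseteq> C" "D <#> H = P"
proof -
  have "finite H" using assms(1) P by (rule finite_subgroup_of_invariant_set)
  have few_missing: "2 * card ((p <# H) - A) < card H" if "p \<in> P" for p
  proof -
    have "(p <# H) - A \<subseteq> sym_diff A P"
      using l_coset_subset_of_set_mult_subset[OF P(4) that] by auto
    then have "card ((p <# H) - A) \<le> card (sym_diff A P)"
      using \<open>finite A\<close> \<open>finite P\<close> by (intro card_mono) auto
    with close show ?thesis by linarith
  qed
  have "H \<subseteq> set_inv A <#> A"
    using P(1,3) few_missing subgroup_subset_set_inv_mult[OF assms(1) \<open>finite H\<close>] by blast
  obtain C where C: "C \<subseteq> A" "A \<subseteq> C <#> H" "card C = card ((\<lambda>a. a <# H) ` A)"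
    using exists_left_transversal[OF assms(1,2)] .
  have "(p <# H) \<inter> A \<noteq> {}" if "p \<in> P" for p
  proof
    assume "(p <# H) \<inter> A = {}"
    then have "(p <# H) - A = p <# H" by blast
    moreover have "card (p <# H) = card H"
      using that P(1) subgroup.subset[OF assms(1)] by (intro card_l_coset) auto
    ultimately show False using few_missing[OF that] by simp
  qed
  then have "(C \<inter> P) <#> H = P"
    using C(1) assms(2)
    by (intro set_mult_representatives_of_invariant_set[OF assms(1) P(1,4) _ C(2)]) auto
  with C that[of C "C \<inter> P"] \<open>H \<subseteq> set_inv A <#> A\<close> show thesis by blast
qed

section \<open>The stabiliser of an almost transporter\<close>

definition right_stabiliser :: "'a set \<Rightarrow> 'a set" where
  "right_stabiliser P = {x \<in> carrier G. P #> x = P}"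

lemma right_stabiliser_closed: "right_stabiliser P \<subseteq> carrier G"
  by (auto simp: right_stabiliser_def)

lemma subgroup_right_stabiliser:
  assumes "P \<subseteq> carrier G"
  shows "subgroup (right_stabiliser P) G"
proof (rule subgroup.intro)
  fix x assume x: "x \<in> right_stabiliser P"
  with assms coset_mult_inv2[of P \<one> x] show "inv x \<in> right_stabiliser P"
    by (simp add: right_stabiliser_def)
qed (use assms in \<open>auto simp: right_stabiliser_def simp flip: coset_mult_assoc\<close>)

lemma set_mult_right_stabiliser_subset: "P <#> right_stabiliser P \<subseteq> P"
  by (auto simp: set_mult_def right_stabiliser_def r_coset_def)

lemma mem_right_stabiliser_r_coset_iff:
  assumes "x \<in> carrier G" "y \<in> carrier G" "P \<subseteq> carrier G"
  shows "x \<in> right_stabiliser (P #> y) \<longleftrightarrow> y \<otimes> x \<otimes> inv y \<in> right_stabiliser P"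
proof -
  have "(P #> y) #> x = P #> y \<longleftrightarrow> P #> (y \<otimes> x) = P #> y"
    using assms by (simp add: coset_mult_assoc)
  also have "\<dots> \<longleftrightarrow> P #> (y \<otimes> x \<otimes> inv y) = P"
    using assms coset_mult_inv1[of P "y \<otimes> x" y] coset_mult_inv2[of P "y \<otimes> x" y] by auto
  finally show ?thesis using assms by (simp add: right_stabiliser_def)
qed

lemma l_coset_right_stabiliser_r_coset:
  assumes "y \<in> carrier G" "P \<subseteq> carrier G"
  shows "y <# right_stabiliser (P #> y) = right_stabiliser P #> y"
proof -
  have "z \<in> y <# right_stabiliser (P #> y) \<longleftrightarrow> z \<in> right_stabiliser P #> y"
    if "z \<in> carrier G" for z
  proof -
    have "z \<in> y <# right_stabiliser (P #> y) \<longleftrightarrow> y \<otimes> (inv y \<otimes> z) \<otimes> inv y \<in> right_stabiliser P"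
      using assms that right_stabiliser_closed
      by (simp add: mem_l_coset_iff mem_right_stabiliser_r_coset_iff)
    also have "y \<otimes> (inv y \<otimes> z) \<otimes> inv y = z \<otimes> inv y"
      using assms(1) that by (simp flip: m_assoc)
    also have "\<dots> \<in> right_stabiliser P \<longleftrightarrow> z \<in> right_stabiliser P #> y"
      using assms(1) that right_stabiliser_closed by (intro mem_r_coset_iff[symmetric])
    finally show ?thesis .
  qed
  then show ?thesis
    using l_coset_subset_G[OF right_stabiliser_closed assms(1)]
      r_coset_subset_G[OF right_stabiliser_closed assms(1)]
    by blast
qed

lemma card_left_cosets_right_stabiliser_r_coset_le:
  assumes "y \<in> carrier G" "P \<subseteq> carrier G" "X \<subseteq> carrier G" "finite X"
  shows "card ((\<lambda>x. x <# right_stabiliser (P #> y)) ` (X #> y))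
      \<le> card ((\<lambda>x. x <# right_stabiliser P) ` X)"
proof -
  have "(x \<otimes> y) <# right_stabiliser (P #> y) = (x <# right_stabiliser P) #> y" if "x \<in> X" for x
  proof -
    have "x \<in> carrier G" using that assms(3) by blast
    then have "(x \<otimes> y) <# right_stabiliser (P #> y) = x <# (y <# right_stabiliser (P #> y))"
      using assms(1) right_stabiliser_closed by (intro lcos_m_assoc[symmetric])
    also have "\<dots> = x <# (right_stabiliser P #> y)"
      using assms(1,2) by (simp add: l_coset_right_stabiliser_r_coset)
    also have "\<dots> = (x <# right_stabiliser P) #> y"
      using \<open>x \<in> carrier G\<close> assms(1) right_stabiliser_closed by (intro coset_assoc)
    finally show ?thesis .
  qed
  then have "(\<lambda>x. x <# right_stabiliser (P #> y)) ` (X #> y)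
      = (\<lambda>S. S #> y) ` (\<lambda>x. x <# right_stabiliser P) ` X"
    by (simp add: r_coset_eq_image[where Y = X] image_image)
  with assms(4) show ?thesis by (simp add: card_image_le)
qed

definition almost_transporter :: "real \<Rightarrow> 'a set \<Rightarrow> 'a set \<Rightarrow> 'a set" where
  "almost_transporter \<delta> Y A =
     {g \<in> carrier G. real (card {y \<in> Y. g \<otimes> y \<notin> A}) \<le> \<delta> * real (card Y)}"

lemma almost_transporter_closed: "almost_transporter \<delta> Y A \<subseteq> carrier G"
  by (auto simp: almost_transporter_def)

lemma card_not_in_of_mem_almost_transporter:
  "g \<in> almost_transporter \<delta> Y A \<Longrightarrow> real (card {y \<in> Y. g \<otimes> y \<notin> A}) \<le> \<delta> * real (card Y)"
  by (simp add: almost_transporter_def)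

lemma card_in_of_not_mem_almost_transporter:
  fixes \<delta> :: real
  assumes "homogeneous (product_in G A) (carrier G) \<delta> Y" "g \<in> carrier G"
    "g \<notin> almost_transporter \<delta> Y A"
  shows "card {y \<in> Y. g \<otimes> y \<in> A} \<le> \<delta> * card Y"
  using assms unfolding homogeneous_def almost_transporter_def by auto

lemma one_mem_almost_transporter:
  fixes \<delta> :: real
  assumes "Y \<subseteq> A" "A \<subseteq> carrier G" "0 \<le> \<delta>"
  shows "\<one> \<in> almost_transporter \<delta> Y A"
proof -
  have "{y \<in> Y. \<one> \<otimes> y \<notin> A} = {}" using assms(1,2) by (auto simp: subset_iff)
  then have "card {y \<in> Y. \<one> \<otimes> y \<notin> A} = 0" by (simp only: card.empty)
  with assms(3) show ?thesis by (simp add: almost_transporter_def)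
qed

lemma almost_transporter_subset:
  fixes \<delta> :: real
  assumes "Y \<subseteq> carrier G" "finite Y" "Y \<noteq> {}" "\<delta> < 1"
  shows "almost_transporter \<delta> Y A \<subseteq> A <#> set_inv Y"
proof
  fix g assume g: "g \<in> almost_transporter \<delta> Y A"
  have "\<delta> * card Y < 1 * real (card Y)"
    using assms(2-4) by (intro mult_strict_right_mono) (auto simp: card_gt_0_iff)
  with card_not_in_of_mem_almost_transporter[OF g] have "{y \<in> Y. g \<otimes> y \<notin> A} \<noteq> Y" by auto
  then obtain y where y: "y \<in> Y" "g \<otimes> y \<in> A" by auto
  moreover have "g = (g \<otimes> y) \<otimes> inv y"
    using y(1) g almost_transporter_closed assms(1) by (simp add: m_assoc subset_iff)
  ultimately show "g \<in> A <#> set_inv Y" unfolding set_mult_def SET_INV_def by blast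
qed

lemma finite_almost_transporter:
  fixes \<delta> :: real
  assumes "A \<subseteq> carrier G" "finite A" "Y \<subseteq> A" "Y \<noteq> {}" "\<delta> < 1"
  shows "finite (almost_transporter \<delta> Y A)"
proof -
  have Y: "Y \<subseteq> carrier G" "finite Y" using assms(1-3) finite_subset by blast+
  then have "almost_transporter \<delta> Y A \<subseteq> A <#> set_inv Y"
    using assms(4,5) by (rule almost_transporter_subset)
  moreover have "finite (A <#> set_inv Y)"
    using assms(2) Y(2) by (intro finite_set_mult finite_set_inv)
  ultimately show ?thesis by (rule finite_subset)
qed

lemma card_separated_translates_Int_le:
  fixes \<delta> :: real
  assumes "homogeneous (product_in G A) (carrier G) \<delta> Y" "Y \<subseteq> carrier G" "finite Y"
    and "g \<in> carrier G" "h \<in> carrier G" "h' \<in> carrier G"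
    and "g \<otimes> h \<in> almost_transporter \<delta> Y A" "g \<otimes> h' \<notin> almost_transporter \<delta> Y A"
  shows "card ((h <# Y) \<inter> (h' <# Y)) \<le> 2 * \<delta> * card Y"
proof -
  let ?out = "{y \<in> Y. (g \<otimes> h) \<otimes> y \<notin> A}" and ?in = "{y \<in> Y. (g \<otimes> h') \<otimes> y \<in> A}"
  have "(h <# Y) \<inter> (h' <# Y) \<subseteq> (h <# ?out) \<union> (h' <# ?in)"
  proof
    fix z assume "z \<in> (h <# Y) \<inter> (h' <# Y)"
    then obtain y y' where y: "y \<in> Y" "z = h \<otimes> y" "y' \<in> Y" "z = h' \<otimes> y'"
      by (auto simp: l_coset_eq_image)
    have "(g \<otimes> h) \<otimes> y = g \<otimes> z" using y(1,2) assms(2,4,5) by (auto simp: m_assoc)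
    moreover have "(g \<otimes> h') \<otimes> y' = g \<otimes> z" using y(3,4) assms(2,4,6) by (auto simp: m_assoc)
    ultimately have "y \<in> ?out \<or> y' \<in> ?in" using y(1,3) by auto
    then show "z \<in> (h <# ?out) \<union> (h' <# ?in)"
      using y unfolding l_coset_eq_image by blast
  qed
  then have "card ((h <# Y) \<inter> (h' <# Y)) \<le> card ((h <# ?out) \<union> (h' <# ?in))"
    using assms(3) by (intro card_mono) (auto simp: l_coset_eq_image)
  also have "\<dots> \<le> card (h <# ?out) + card (h' <# ?in)" by (rule card_Un_le)
  also have "\<dots> = card ?out + card ?in"
    using assms(2,5,6) by (intro arg_cong2[where f = "(+)"] card_l_coset) auto
  finally have "card ((h <# Y) \<inter> (h' <# Y)) \<le> card ?out + card ?in" .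
  moreover have "card ?out \<le> \<delta> * card Y"
    using assms(7) by (rule card_not_in_of_mem_almost_transporter)
  moreover have "card ?in \<le> \<delta> * card Y"
    using assms(1,4,6,8) by (intro card_in_of_not_mem_almost_transporter) auto
  ultimately show ?thesis by linarith
qed

lemma card_translates_Int_le:
  fixes \<delta> :: real
  assumes "homogeneous (product_in G A) (carrier G) \<delta> Y" "Y \<subseteq> carrier G" "finite Y"
    and h: "h \<in> carrier G" "h' \<in> carrier G"
    and "inv h \<otimes> h' \<notin> right_stabiliser (almost_transporter \<delta> Y A)"
  shows "card ((h <# Y) \<inter> (h' <# Y)) \<le> 2 * \<delta> * card Y"
proof -
  let ?P = "almost_transporter \<delta> Y A"
  have P: "?P \<subseteq> carrier G" by (rule almost_transporter_closed)
  have "?P #> (inv h \<otimes> h') \<noteq> ?P" using assms(6) h by (simp add: right_stabiliser_def)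
  then have "?P #> inv h \<noteq> ?P #> inv h'"
    using coset_mult_inv2[OF _ _ _ P, of "inv h" "inv h'"] h by auto
  moreover have "?P #> inv h \<subseteq> carrier G" "?P #> inv h' \<subseteq> carrier G"
    using P h by (simp_all add: r_coset_subset_G)
  ultimately obtain g where g: "g \<in> carrier G" "g \<in> ?P #> inv h \<longleftrightarrow> g \<notin> ?P #> inv h'" by blast
  then consider (left) "g \<otimes> h \<in> ?P" "g \<otimes> h' \<notin> ?P" | (right) "g \<otimes> h' \<in> ?P" "g \<otimes> h \<notin> ?P"
    using h P by (auto simp: mem_r_coset_iff)
  then show ?thesis
  proof cases
    case left
    with assms(1-3) g(1) h show ?thesis by (rule card_separated_translates_Int_le)
  next
    case right
    with assms(1-3) g(1) h(2,1) have "card ((h' <# Y) \<inter> (h <# Y)) \<le> 2 * \<delta> * card Y"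
      by (rule card_separated_translates_Int_le)
    then show ?thesis by (simp only: Int_commute)
  qed
qed

lemma card_left_cosets_right_stabiliser_le:
  fixes L \<delta> :: real
  assumes hom: "homogeneous (product_in G A) (carrier G) \<delta> Y"
    and Y: "Y \<subseteq> carrier G" "finite Y" "Y \<noteq> {}"
    and X: "X \<subseteq> carrier G" "finite X" "card (X <#> Y) \<le> L * card Y"
    and bounds: "0 \<le> \<delta>" "0 \<le> L" "4 * \<delta> * L \<le> 1"
  shows "card ((\<lambda>x. x <# right_stabiliser (almost_transporter \<delta> Y A)) ` X) \<le> 2 * L"
proof -
  define H where "H = right_stabiliser (almost_transporter \<delta> Y A)"
  have "subgroup H G"
    unfolding H_def by (intro subgroup_right_stabiliser almost_transporter_closed)
  then obtain C where C: "C \<subseteq> X" "inj_on (\<lambda>x. x <# H) C" "card C = card ((\<lambda>x. x <# H) ` X)"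
    using exists_left_transversal[OF _ X(1)] by metis
  have "card C \<le> 2 * L"
  proof (rule card_almost_disjoint_family_le[where B = "\<lambda>x. x <# Y" and U = "X <#> Y"
        and s = "card Y" and t = "2 * \<delta> * card Y"])
    show "finite C" using C(1) X(2) by (rule finite_subset)
    show "finite (X <#> Y)" using X(2) Y(2) by (rule finite_set_mult)
    show "x <# Y \<subseteq> X <#> Y" if "x \<in> C" for x
      using that C(1) by (auto simp: l_coset_def set_mult_def)
    show "real (card (x <# Y)) = card Y" if "x \<in> C" for x
      using that C(1) X(1) Y(1) card_l_coset by auto
    show "card ((x <# Y) \<inter> (x' <# Y)) \<le> 2 * \<delta> * card Y" if "x \<in> C" "x' \<in> C" "x \<noteq> x'" for x x'
    proof (rule card_translates_Int_le[OF hom Y(1,2)])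
      show "x \<in> carrier G" "x' \<in> carrier G" using that C(1) X(1) by auto
      then show "inv x \<otimes> x' \<notin> right_stabiliser (almost_transporter \<delta> Y A)"
        using that C(2) l_coset_eq_iff[OF \<open>subgroup H G\<close>] unfolding H_def by (metis inj_onD)
    qed
    have "(4 * \<delta> * L) * card Y \<le> 1 * real (card Y)"
      using bounds(3) by (intro mult_right_mono) auto
    then show "L * (2 * \<delta> * card Y) \<le> card Y / 2" by (simp add: mult_ac)
  qed (use Y(2,3) X(3) bounds(1,2) in \<open>auto simp: card_gt_0_iff\<close>)
  with C(3) show ?thesis by (simp add: H_def)
qed

lemma card_left_cosets_translated_quotient_set_le:
  fixes L \<delta> :: real
  assumes hom: "homogeneous (product_in G A) (carrier G) \<delta> Y"
    and A: "A \<subseteq> carrier G" "finite A" and Y: "Y \<subseteq> A" "Y \<noteq> {}"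
    and L: "card (A <#> set_inv A <#> A) \<le> L * card Y"
    and bounds: "0 \<le> \<delta>" "0 \<le> L" "4 * \<delta> * L \<le> 1" and y: "y \<in> carrier G"
  shows "card ((\<lambda>x. x <# right_stabiliser (almost_transporter \<delta> Y A #> y)) `
    ((A <#> set_inv A) #> y)) \<le> 2 * L"
proof -
  let ?U = "A <#> set_inv A" and ?T = "almost_transporter \<delta> Y A"
  have U: "?U \<subseteq> carrier G" "finite ?U"
    using A by (simp_all add: finite_set_mult finite_set_inv set_mult_closed set_inv_closed)
  have "finite Y" "Y \<subseteq> carrier G" using Y(1) A finite_subset by blast+
  have "card (?U <#> Y) \<le> card (?U <#> A)"
    using Y(1) by (intro card_mono finite_set_mult[OF U(2) A(2)] mono_set_mult) auto
  with L have "card (?U <#> Y) \<le> L * card Y" by linarith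
  then have "card ((\<lambda>x. x <# right_stabiliser ?T) ` ?U) \<le> 2 * L"
    using hom \<open>Y \<subseteq> carrier G\<close> \<open>finite Y\<close> Y(2) U bounds
    by (intro card_left_cosets_right_stabiliser_le)
  with card_left_cosets_right_stabiliser_r_coset_le[OF y almost_transporter_closed U, of \<delta> Y A]
  show ?thesis by linarith
qed

lemma sym_diff_r_coset_subset:
  assumes "y \<in> carrier G" "A \<subseteq> carrier G" "T \<subseteq> U" "A #> inv y \<subseteq> U"
  shows "sym_diff A (T #> y) \<subseteq> {g \<in> U. (g \<otimes> y \<in> A) \<noteq> (g \<in> T)} #> y"
proof
  fix z assume z: "z \<in> sym_diff A (T #> y)"
  show "z \<in> {g \<in> U. (g \<otimes> y \<in> A) \<noteq> (g \<in> T)} #> y"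
  proof (cases "z \<in> A")
    case True
    then have "z = (z \<otimes> inv y) \<otimes> y"
      using assms(1,2) by (simp add: m_assoc subset_iff)
    moreover have "z \<otimes> inv y \<in> U" using True assms(4) by (auto simp: r_coset_eq_image)
    ultimately show ?thesis using z True by (auto simp: r_coset_eq_image)
  next
    case False
    with z assms(3) show ?thesis by (auto simp: r_coset_eq_image)
  qed
qed

lemma exists_translate_close_to_almost_transporter:
  fixes \<delta> :: real
  assumes hom: "homogeneous (product_in G A) (carrier G) \<delta> Y"
    and A: "A \<subseteq> carrier G" "finite A" and Y: "Y \<subseteq> A" "Y \<noteq> {}" and "\<delta> < 1"
  obtains y where "y \<in> Y"
    "card (sym_diff A (almost_transporter \<delta> Y A #> y)) \<le> \<delta> * card (A <#> set_inv A)"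
proof -
  let ?U = "A <#> set_inv A" and ?T = "almost_transporter \<delta> Y A"
  have "finite Y" "Y \<subseteq> carrier G" using Y(1) A finite_subset by blast+
  have U: "finite ?U" "?U \<subseteq> carrier G"
    using A by (simp_all add: finite_set_mult finite_set_inv set_mult_closed set_inv_closed)
  have "?T \<subseteq> A <#> set_inv Y"
    using \<open>Y \<subseteq> carrier G\<close> \<open>finite Y\<close> Y(2) \<open>\<delta> < 1\<close> by (rule almost_transporter_subset)
  also have "\<dots> \<subseteq> ?U" using Y(1) by (intro mono_set_mult) (auto simp: SET_INV_def)
  finally have "?T \<subseteq> ?U" .
  have "card {y \<in> Y. (g \<otimes> y \<in> A) \<noteq> (g \<in> ?T)} \<le> \<delta> * card Y" if "g \<in> ?U" for g
    using card_not_in_of_mem_almost_transporter[of g \<delta> Y A]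
      card_in_of_not_mem_almost_transporter[OF hom, of g] that U(2)
    by (cases "g \<in> ?T") auto
  then obtain y where y: "y \<in> Y" "card {g \<in> ?U. (g \<otimes> y \<in> A) \<noteq> (g \<in> ?T)} \<le> \<delta> * card ?U"
    using exists_fibre_card_le_average[OF U(1) \<open>finite Y\<close> Y(2),
        where E = "\<lambda>g y. (g \<otimes> y \<in> A) \<noteq> (g \<in> ?T)"]
    by blast
  let ?mismatch = "{g \<in> ?U. (g \<otimes> y \<in> A) \<noteq> (g \<in> ?T)}"
  have "y \<in> A" "y \<in> carrier G" using y(1) Y(1) A(1) by auto
  then have "A #> inv y \<subseteq> ?U" by (auto simp: r_coset_eq_image intro: mult_inv_mem_set_mult)
  with \<open>y \<in> carrier G\<close> A(1) \<open>?T \<subseteq> ?U\<close> have "sym_diff A (?T #> y) \<subseteq> ?mismatch #> y"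
    by (rule sym_diff_r_coset_subset)
  then have "card (sym_diff A (?T #> y)) \<le> card (?mismatch #> y)"
    using U(1) by (intro card_mono) (auto simp: r_coset_eq_image)
  also have "\<dots> = card ?mismatch" using \<open>y \<in> carrier G\<close> U(2) by (intro card_r_coset) auto
  finally show thesis using that y by fastforce
qed

end

section \<open>Approximation by cosets of a subgroup\<close>

definition coset_approximable :: "('a, 'b) monoid_scheme \<Rightarrow> 'a set \<Rightarrow> real \<Rightarrow> real \<Rightarrow> bool" where
  "coset_approximable G A m \<epsilon> \<longleftrightarrow>
     (\<exists>H. subgroup H G \<and> H \<subseteq> set_inv\<^bsub>G\<^esub> A <#>\<^bsub>G\<^esub> A \<and>
        (\<exists>C\<subseteq>A. A \<subseteq> C <#>\<^bsub>G\<^esub> H \<and> real (card C) \<le> m \<and>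
           (\<exists>D\<subseteq>C. real (card (sym_diff A (D <#>\<^bsub>G\<^esub> H))) < \<epsilon> * real (card H))))"

lemma coset_approximableI:
  assumes "subgroup H G" "H \<subseteq> set_inv\<^bsub>G\<^esub> A <#>\<^bsub>G\<^esub> A" "C \<subseteq> A" "A \<subseteq> C <#>\<^bsub>G\<^esub> H" "real (card C) \<le> m"
    and "D \<subseteq> C" "real (card (sym_diff A (D <#>\<^bsub>G\<^esub> H))) < \<epsilon> * real (card H)"
  shows "coset_approximable G A m \<epsilon>"
  unfolding coset_approximable_def using assms by blast

lemma coset_approximableE:
  assumes "coset_approximable G A m \<epsilon>"
  obtains H C D where "subgroup H G" "H \<subseteq> set_inv\<^bsub>G\<^esub> A <#>\<^bsub>G\<^esub> A" "C \<subseteq> A" "A \<subseteq> C <#>\<^bsub>G\<^esub> H"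
    "real (card C) \<le> m" "D \<subseteq> C" "real (card (sym_diff A (D <#>\<^bsub>G\<^esub> H))) < \<epsilon> * real (card H)"
  using assms unfolding coset_approximable_def by blast

lemma coset_approximable_mono:
  assumes "coset_approximable G A m \<epsilon>" "m \<le> m'"
  shows "coset_approximable G A m' \<epsilon>"
proof -
  from assms(1) obtain H C D where "subgroup H G" "H \<subseteq> set_inv\<^bsub>G\<^esub> A <#>\<^bsub>G\<^esub> A" "C \<subseteq> A"
    "A \<subseteq> C <#>\<^bsub>G\<^esub> H" "real (card C) \<le> m" "D \<subseteq> C"
    "real (card (sym_diff A (D <#>\<^bsub>G\<^esub> H))) < \<epsilon> * real (card H)"
    by (rule coset_approximableE)
  moreover have "real (card C) \<le> m'" using calculation(5) assms(2) by simp
  ultimately show ?thesis by (intro coset_approximableI)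
qed

lemma (in group) coset_approximable_of_near_invariant_set:
  fixes \<delta> \<epsilon> m :: real
  assumes H: "subgroup H G" and A: "A \<subseteq> carrier G" "finite A"
    and P: "P \<subseteq> carrier G" "finite P" "P \<noteq> {}" "P <#> H \<subseteq> P"
    and X: "A \<subseteq> X" "X \<subseteq> carrier G" "finite X" "card ((\<lambda>x. x <# H) ` X) \<le> m"
    and close: "card (sym_diff A P) \<le> \<delta> * card X"
    and bounds: "0 \<le> \<delta>" "\<delta> * m < \<epsilon>" "\<epsilon> \<le> 1 / 2"
  shows "coset_approximable G A m \<epsilon>"
proof -
  have "finite H" using H P by (rule finite_subgroup_of_invariant_set)
  with subgroup.one_closed[OF H] have "0 < real (card H)" by (auto simp: card_gt_0_iff)
  have "card X \<le> card ((\<lambda>x. x <# H) ` X) * card H"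
    using H \<open>finite H\<close> X(2,3) by (rule card_le_card_left_cosets_mult)
  then have "real (card X) \<le> real (card ((\<lambda>x. x <# H) ` X)) * card H"
    by (simp flip: of_nat_mult)
  also have "\<dots> \<le> m * card H" using X(4) by (intro mult_right_mono) auto
  finally have "\<delta> * card X \<le> \<delta> * m * card H"
    using bounds(1) by (simp add: mult_left_mono mult.assoc)
  also have "\<dots> < \<epsilon> * card H"
    using bounds(2) \<open>0 < real (card H)\<close> by (intro mult_strict_right_mono)
  finally have "card (sym_diff A P) < \<epsilon> * card H" using close by linarith
  moreover have "\<epsilon> * card H \<le> 1 / 2 * real (card H)"
    using bounds(3) by (intro mult_right_mono) auto
  ultimately have "2 * card (sym_diff A P) < card H" by linarith
  with H A P obtain C D where CD: "H \<subseteq> set_inv A <#> A" "C \<subseteq> A" "A \<subseteq> C <#> H"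
    "card C = card ((\<lambda>a. a <# H) ` A)" "D \<subseteq> C" "D <#> H = P"
    by (rule coset_union_near_invariant_set)
  have "card C \<le> card ((\<lambda>x. x <# H) ` X)"
    unfolding CD(4) using X(1,3) by (intro card_mono image_mono) auto
  then have "card C \<le> m" using X(4) by linarith
  with H CD \<open>card (sym_diff A P) < \<epsilon> * card H\<close> show ?thesis
    by (intro coset_approximableI[of H G A C m D]) auto
qed

lemma (in group) coset_approximable_of_homogeneous:
  fixes \<epsilon> L :: real
  assumes A: "A \<subseteq> carrier G" "finite A" and Y: "Y \<subseteq> A" "Y \<noteq> {}"
    and hom: "homogeneous (product_in G A) (carrier G) (\<epsilon> / (4 * L)) Y"
    and L: "1 \<le> L" "card (A <#> set_inv A <#> A) \<le> L * card Y"
    and \<epsilon>: "0 < \<epsilon>" "\<epsilon> \<le> 1 / 2"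
  shows "coset_approximable G A (2 * L) \<epsilon>"
proof -
  define \<delta> where "\<delta> = \<epsilon> / (4 * L)"
  have \<delta>: "0 < \<delta>" "\<delta> < 1" "4 * \<delta> * L \<le> 1" "\<delta> * (2 * L) < \<epsilon>"
    unfolding \<delta>_def using \<epsilon> L(1) by (auto simp: field_simps)
  note hom = hom[folded \<delta>_def]
  define U where "U = A <#> set_inv A"
  have U: "U \<subseteq> carrier G" "finite U"
    using A by (simp_all add: U_def finite_set_mult finite_set_inv set_mult_closed set_inv_closed)
  define T where "T = almost_transporter \<delta> Y A"
  have T: "T \<subseteq> carrier G" "finite T" "\<one> \<in> T"
    unfolding T_def using A Y \<delta>(1,2)
    by (simp_all add: almost_transporter_closed finite_almost_transporter one_mem_almost_transporter)
  obtain y where y: "y \<in> Y" "card (sym_diff A (T #> y)) \<le> \<delta> * card U"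
    using exists_translate_close_to_almost_transporter[OF hom A Y \<delta>(2)] unfolding U_def T_def .
  have "y \<in> A" "y \<in> carrier G" using y(1) Y(1) A(1) by auto
  have "T #> y \<subseteq> carrier G" using T(1) \<open>y \<in> carrier G\<close> by (rule r_coset_subset_G)
  show ?thesis
  proof (rule coset_approximable_of_near_invariant_set[where P = "T #> y" and X = "U #> y"])
    show "subgroup (right_stabiliser (T #> y)) G"
      using \<open>T #> y \<subseteq> carrier G\<close> by (rule subgroup_right_stabiliser)
    show "(T #> y) <#> right_stabiliser (T #> y) \<subseteq> T #> y"
      by (rule set_mult_right_stabiliser_subset)
    show "finite (T #> y)" "T #> y \<noteq> {}" "finite (U #> y)"
      using T(2,3) U(2) by (auto simp: r_coset_eq_image)
    show "U #> y \<subseteq> carrier G" using U(1) \<open>y \<in> carrier G\<close> by (rule r_coset_subset_G)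
    show "A \<subseteq> U #> y"
      unfolding U_def using A(1) \<open>y \<in> A\<close> by (rule subset_r_coset_quotient_set)
    show "card ((\<lambda>x. x <# right_stabiliser (T #> y)) ` (U #> y)) \<le> 2 * L"
      unfolding T_def U_def using hom A Y L \<delta> \<open>y \<in> carrier G\<close>
      by (intro card_left_cosets_translated_quotient_set_le) auto
    show "card (sym_diff A (T #> y)) \<le> \<delta> * card (U #> y)"
      using y(2) \<open>y \<in> carrier G\<close> U(1) by (simp add: card_r_coset)
  qed (use A \<epsilon> \<delta> \<open>T #> y \<subseteq> carrier G\<close> in auto)
qed

section \<open>Explicit constants\<close>

lemma covering_number_le:
  fixes c \<epsilon> \<eta> :: real and n :: nat
  assumes "1 \<le> c" "0 < \<epsilon>" "\<epsilon> \<le> 1" "(\<epsilon> / (4 * c)) ^ n \<le> \<eta>"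
  shows "2 * (c / \<eta>) \<le> 2 * 4 ^ n * (c * inverse \<epsilon>) powr real (n + 1)"
proof -
  have r: "0 < (\<epsilon> / (4 * c)) ^ n" using assms(1,2) by simp
  then have "2 * (c / \<eta>) \<le> 2 * (c / (\<epsilon> / (4 * c)) ^ n)"
    using assms(1,4) by (intro mult_left_mono divide_left_mono) auto
  also have "\<dots> = 2 * (c * (4 * (c * inverse \<epsilon>)) ^ n)"
    using assms(1,2) by (simp add: field_simps power_divide power_mult_distrib)
  also have "\<dots> \<le> 2 * (c * inverse \<epsilon> * (4 * (c * inverse \<epsilon>)) ^ n)"
    using assms(1-3) by (intro mult_left_mono mult_right_mono) (auto simp: field_simps)
  also have "\<dots> = 2 * 4 ^ n * (c * inverse \<epsilon>) ^ (n + 1)"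
    by (simp add: power_mult_distrib mult_ac)
  also have "\<dots> = 2 * 4 ^ n * (c * inverse \<epsilon>) powr real (n + 1)"
    using assms(1,2) by (subst powr_realpow) auto
  finally show ?thesis .
qed

lemma suitable_consts_iff:
  "suitable_consts G k K N \<longleftrightarrow>
     (\<forall>(c::real) A. 1 \<le> c \<longrightarrow> A \<subseteq> carrier G \<longrightarrow> finite A \<longrightarrow> A \<noteq> {} \<longrightarrow> k_stable G k A \<longrightarrow>
        real (card (A <#>\<^bsub>G\<^esub> set_inv\<^bsub>G\<^esub> A <#>\<^bsub>G\<^esub> A)) \<le> c * real (card A) \<longrightarrow>
        (\<forall>\<epsilon>::real. 0 < \<epsilon> \<longrightarrow> \<epsilon> \<le> 1 / 2 \<longrightarrow>
           coset_approximable G A (K * (c * inverse \<epsilon>) powr N) \<epsilon>))"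
  unfolding suitable_consts_def coset_approximable_def by (rule refl)

lemma (in group) suitable_consts_explicit:
  fixes k :: nat
  defines "n \<equiv> 2 ^ (2 ^ Suc k - 2)"
  shows "suitable_consts G k (2 * 4 ^ n) (real (n + 1))"
  unfolding suitable_consts_iff
proof (intro allI impI)
  fix c \<epsilon> :: real and A
  assume c: "1 \<le> c" and A: "A \<subseteq> carrier G" "finite A" "A \<noteq> {}" and stable: "k_stable G k A"
    and triple: "real (card (A <#> set_inv A <#> A)) \<le> c * real (card A)"
    and \<epsilon>: "0 < \<epsilon>" "\<epsilon> \<le> 1 / 2"
  define r where "r = \<epsilon> / (4 * c)"
  have r: "0 < r" "r \<le> 1" unfolding r_def using c \<epsilon> by (auto simp: field_simps)
  have "\<not> splitting_tree (product_in G A) (carrier G) (2 ^ Suc k - 2) A"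
    using k_stable_no_ladder[OF stable] ladder_of_splitting_tree splitting_tree_mono A(1) by metis
  then obtain Y \<eta> where Y: "Y \<subseteq> A" "Y \<noteq> {}" and \<eta>: "r ^ n \<le> \<eta>" "\<eta> \<le> 1" "\<eta> * card A \<le> card Y"
    and hom: "homogeneous (product_in G A) (carrier G) (r * \<eta>) Y"
    unfolding n_def using exists_homogeneous_subset[OF _ r A(2,3)] by metis
  have "0 < r ^ n" using r(1) by simp
  with \<eta>(1) have "0 < \<eta>" by linarith
  define L where "L = c / \<eta>"
  have "1 \<le> L" unfolding L_def using \<open>0 < \<eta>\<close> \<eta>(2) c by (simp add: field_simps)
  have "c * card A = L * (\<eta> * card A)" unfolding L_def using \<open>0 < \<eta>\<close> by simp
  also have "\<dots> \<le> L * card Y" using \<eta>(3) \<open>1 \<le> L\<close> by (intro mult_left_mono) auto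
  finally have "card (A <#> set_inv A <#> A) \<le> L * card Y" using triple by linarith
  moreover have "r * \<eta> = \<epsilon> / (4 * L)" unfolding r_def L_def by simp
  ultimately have "coset_approximable G A (2 * L) \<epsilon>"
    using A(1,2) Y hom \<open>1 \<le> L\<close> \<epsilon> by (intro coset_approximable_of_homogeneous) auto
  moreover have "2 * L \<le> 2 * 4 ^ n * (c * inverse \<epsilon>) powr real (n + 1)"
    unfolding L_def using c \<epsilon> \<eta>(1)[unfolded r_def] by (intro covering_number_le) auto
  ultimately show "coset_approximable G A (2 * 4 ^ n * (c * inverse \<epsilon>) powr real (n + 1)) \<epsilon>"
    by (rule coset_approximable_mono)
qed

section \<open>Transfer from countable groups\<close>

lemma (in group) countable_generate:
  assumes "countable X" "X \<subseteq> carrier G"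
  shows "countable (generate G X)"
proof -
  define W where "W = X \<union> m_inv G ` X"
  define R where "R = {(g, g \<otimes> w) |g w. g \<in> carrier G \<and> w \<in> W}"
  have W: "countable W" "W \<subseteq> carrier G" using assms by (auto simp: W_def)
  have translate: "(u \<otimes> g, u \<otimes> h) \<in> R\<^sup>*" if "(g, h) \<in> R\<^sup>*" "u \<in> carrier G" for u g h
    using that(1)
  proof induction
    case (step y z)
    then obtain w where w: "w \<in> W" "y \<in> carrier G" "z = y \<otimes> w" by (auto simp: R_def)
    then have "u \<otimes> y \<in> carrier G" "u \<otimes> z = (u \<otimes> y) \<otimes> w"
      using that(2) W(2) by (auto simp: m_assoc)
    with w(1) have "(u \<otimes> y, u \<otimes> z) \<in> R" unfolding R_def by blast
    with step.IH show ?case by (rule rtrancl_into_rtrancl)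
  qed simp
  have letter: "(\<one>, w) \<in> R\<^sup>*" if "w \<in> W" for w
    using that W(2) by (intro r_into_rtrancl) (auto simp: R_def intro!: exI[of _ \<one>] exI[of _ w])
  have "(\<one>, g) \<in> R\<^sup>*" if "g \<in> generate G X" for g
    using that
  proof induction
    case (eng g h)
    have "g \<in> carrier G" using assms(2) eng.hyps(1) by (rule generate_in_carrier)
    with translate[OF eng.IH(2)] have "(g, g \<otimes> h) \<in> R\<^sup>*" by simp
    with eng.IH(1) show ?case by (rule rtrancl_trans)
  qed (auto intro: letter simp: W_def)
  then have "generate G X \<subseteq> R\<^sup>* `` {\<one>}" by auto
  moreover have "countable (R `` Z)" if "countable Z" for Z
  proof -
    have "R `` Z \<subseteq> (\<lambda>(g, w). g \<otimes> w) ` (Z \<times> W)" by (auto simp: R_def)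
    then show ?thesis by (rule countable_subset) (use that W(1) in simp)
  qed
  then have "countable (R\<^sup>* `` {\<one>})" by (intro countable_rtrancl) auto
  ultimately show ?thesis by (rule countable_subset)
qed

lemma (in group) countable_subgroup_embedding:
  assumes "subgroup S G" "countable S"
  obtains G' :: "nat monoid" and \<phi> where "group_hom G' G \<phi>" "inj_on \<phi> (carrier G')"
    "\<phi> ` carrier G' = S"
proof -
  interpret S: subgroup S G by fact
  obtain f :: "'a \<Rightarrow> nat" where f: "inj_on f S" using assms(2) by (auto simp: countable_def)
  define \<phi> where "\<phi> = inv_into S f"
  define G' where "G' = \<lparr>carrier = f ` S, mult = (\<lambda>x y. f (\<phi> x \<otimes> \<phi> y)), one = f \<one>\<rparr>"
  have \<phi>f: "\<phi> (f x) = x" if "x \<in> S" for x using that f by (simp add: \<phi>_def)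
  have "group G'"
  proof (rule groupI)
    fix x y z assume "x \<in> carrier G'" "y \<in> carrier G'" "z \<in> carrier G'"
    then show "x \<otimes>\<^bsub>G'\<^esub> y \<otimes>\<^bsub>G'\<^esub> z = x \<otimes>\<^bsub>G'\<^esub> (y \<otimes>\<^bsub>G'\<^esub> z)"
      by (auto simp: G'_def \<phi>f m_assoc)
  next
    fix x assume "x \<in> carrier G'"
    then obtain u where u: "u \<in> S" "x = f u" by (auto simp: G'_def)
    then show "\<exists>y\<in>carrier G'. y \<otimes>\<^bsub>G'\<^esub> x = \<one>\<^bsub>G'\<^esub>"
      by (intro bexI[of _ "f (inv u)"]) (auto simp: G'_def \<phi>f)
  qed (auto simp: G'_def \<phi>f)
  moreover have "\<phi> \<in> hom G' G" by (auto simp: hom_def G'_def \<phi>f)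
  ultimately have "group_hom G' G \<phi>" by (simp add: group_hom_def group_hom_axioms_def is_group)
  moreover have "inj_on \<phi> (carrier G')" by (auto simp: inj_on_def G'_def \<phi>f)
  moreover have "\<phi> ` carrier G' = S" by (auto simp: G'_def \<phi>f image_image)
  ultimately show thesis by (rule that)
qed

context group_hom
begin

lemma image_set_inv:
  "X \<subseteq> carrier G \<Longrightarrow> h ` (set_inv\<^bsub>G\<^esub> X) = set_inv\<^bsub>H\<^esub> (h ` X)"
  unfolding SET_INV_def by (fastforce simp: subset_iff image_iff)

lemma k_stable_of_image:
  assumes "k_stable H k (h ` A)" "inj_on h (carrier G)" "A \<subseteq> carrier G"
  shows "k_stable G k A"
  unfolding k_stable_def
proof (rule notI, elim exE conjE)
  fix a b :: "nat \<Rightarrow> 'a"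
  assume closed: "\<forall>i\<in>{1..k}. a i \<in> carrier G \<and> b i \<in> carrier G"
    and ab: "\<forall>i\<in>{1..k}. \<forall>j\<in>{1..k}. a i \<otimes>\<^bsub>G\<^esub> b j \<in> A \<longleftrightarrow> i \<le> j"
  have "h (a i) \<otimes>\<^bsub>H\<^esub> h (b j) \<in> h ` A \<longleftrightarrow> i \<le> j" if "i \<in> {1..k}" "j \<in> {1..k}" for i j
  proof -
    have "a i \<in> carrier G" "b j \<in> carrier G" using that closed by auto
    then have "h (a i) \<otimes>\<^bsub>H\<^esub> h (b j) \<in> h ` A \<longleftrightarrow> a i \<otimes>\<^bsub>G\<^esub> b j \<in> A"
      using assms(2,3) by (simp add: inj_on_image_mem_iff flip: hom_mult)
    with ab that show ?thesis by blast
  qed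
  then have "\<not> k_stable H k (h ` A)"
    using closed by (intro not_k_stableI[of k "\<lambda>i. h (a i)" H "\<lambda>i. h (b i)"]) auto
  with assms(1) show False by contradiction
qed

lemma card_image_triple_product:
  assumes "inj_on h (carrier G)" "B \<subseteq> carrier G"
  shows "card (h ` B <#>\<^bsub>H\<^esub> set_inv\<^bsub>H\<^esub> (h ` B) <#>\<^bsub>H\<^esub> h ` B) =
    card (B <#>\<^bsub>G\<^esub> set_inv\<^bsub>G\<^esub> B <#>\<^bsub>G\<^esub> B)"
proof -
  have closed: "set_inv\<^bsub>G\<^esub> B \<subseteq> carrier G" "B <#>\<^bsub>G\<^esub> set_inv\<^bsub>G\<^esub> B \<subseteq> carrier G"
    "B <#>\<^bsub>G\<^esub> set_inv\<^bsub>G\<^esub> B <#>\<^bsub>G\<^esub> B \<subseteq> carrier G"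
    using assms(2) by (simp_all add: G.set_mult_closed G.set_inv_closed)
  have "h ` B <#>\<^bsub>H\<^esub> set_inv\<^bsub>H\<^esub> (h ` B) <#>\<^bsub>H\<^esub> h ` B = h ` (B <#>\<^bsub>G\<^esub> set_inv\<^bsub>G\<^esub> B <#>\<^bsub>G\<^esub> B)"
    using assms(2) closed by (simp add: set_mult_hom[OF homh] image_set_inv)
  also have "card \<dots> = card (B <#>\<^bsub>G\<^esub> set_inv\<^bsub>G\<^esub> B <#>\<^bsub>G\<^esub> B)"
    using assms(1) closed(3) by (intro card_image) (rule inj_on_subset)
  finally show ?thesis .
qed

lemma coset_approximable_image:
  assumes "coset_approximable G B m \<epsilon>" "inj_on h (carrier G)" "B \<subseteq> carrier G"
  shows "coset_approximable H (h ` B) m \<epsilon>"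
proof -
  obtain S C D where S: "subgroup S G" "S \<subseteq> set_inv\<^bsub>G\<^esub> B <#>\<^bsub>G\<^esub> B"
    and C: "C \<subseteq> B" "B \<subseteq> C <#>\<^bsub>G\<^esub> S" "real (card C) \<le> m"
    and D: "D \<subseteq> C" "real (card (sym_diff B (D <#>\<^bsub>G\<^esub> S))) < \<epsilon> * real (card S)"
    using assms(1) by (rule coset_approximableE)
  have closed: "S \<subseteq> carrier G" "C \<subseteq> carrier G" "D \<subseteq> carrier G" "set_inv\<^bsub>G\<^esub> B \<subseteq> carrier G"
    using subgroup.subset[OF S(1)] C(1) D(1) assms(3) G.set_inv_closed by auto
  have card: "card (h ` X) = card X" if "X \<subseteq> carrier G" for X
    using assms(2) that by (intro card_image) (rule inj_on_subset)
  show ?thesis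
  proof (rule coset_approximableI)
    show "subgroup (h ` S) H" using S(1) by (rule subgroup_img_is_subgroup)
    show "h ` S \<subseteq> set_inv\<^bsub>H\<^esub> (h ` B) <#>\<^bsub>H\<^esub> h ` B"
      using image_mono[OF S(2), of h] assms(3) closed
      by (simp add: set_mult_hom[OF homh] image_set_inv)
    show "h ` C \<subseteq> h ` B" using C(1) by (rule image_mono)
    show "h ` B \<subseteq> h ` C <#>\<^bsub>H\<^esub> h ` S"
      using image_mono[OF C(2), of h] closed by (simp add: set_mult_hom[OF homh])
    show "real (card (h ` C)) \<le> m" using C(3) card[OF closed(2)] by simp
    show "h ` D \<subseteq> h ` C" using D(1) by (rule image_mono)
    have DS: "D <#>\<^bsub>G\<^esub> S \<subseteq> carrier G" using closed by (intro G.set_mult_closed)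
    have "sym_diff (h ` B) (h ` D <#>\<^bsub>H\<^esub> h ` S) = h ` (sym_diff B (D <#>\<^bsub>G\<^esub> S))"
      unfolding set_mult_hom[OF homh closed(3,1), symmetric] image_Un
      using assms(3) DS by (simp add: inj_on_image_set_diff[OF assms(2)] subset_iff)
    moreover have "sym_diff B (D <#>\<^bsub>G\<^esub> S) \<subseteq> carrier G" using assms(3) DS by auto
    ultimately show "real (card (sym_diff (h ` B) (h ` D <#>\<^bsub>H\<^esub> h ` S))) < \<epsilon> * real (card (h ` S))"
      using D(2) card closed(1) by simp
  qed
qed

end

lemma suitable_consts_transfer:
  fixes G :: "('a, 'b) monoid_scheme"
  assumes nat_groups: "\<And>G' :: nat monoid. group G' \<Longrightarrow> suitable_consts G' k K N" and "group G"
  shows "suitable_consts G k K N"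
  unfolding suitable_consts_iff
proof (intro allI impI)
  fix c \<epsilon> :: real and A :: "'a set"
  assume c: "1 \<le> c" and A: "A \<subseteq> carrier G" "finite A" "A \<noteq> {}" and stable: "k_stable G k A"
    and triple: "real (card (A <#>\<^bsub>G\<^esub> set_inv\<^bsub>G\<^esub> A <#>\<^bsub>G\<^esub> A)) \<le> c * real (card A)"
    and \<epsilon>: "0 < \<epsilon>" "\<epsilon> \<le> 1 / 2"
  interpret G: group G by fact
  have "subgroup (generate G A) G" "countable (generate G A)"
    using A by (simp_all add: G.generate_is_subgroup G.countable_generate countable_finite)
  then obtain G' :: "nat monoid" and \<phi> where "group_hom G' G \<phi>" and inj: "inj_on \<phi> (carrier G')"
    and range: "\<phi> ` carrier G' = generate G A"
    by (rule G.countable_subgroup_embedding)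
  interpret \<phi>: group_hom G' G \<phi> by fact
  have "A \<subseteq> \<phi> ` carrier G'" unfolding range by (auto intro: generate.incl)
  then obtain B where B: "B \<subseteq> carrier G'" "A = \<phi> ` B" by (auto simp: subset_image_iff)
  have "inj_on \<phi> B" using inj B(1) by (rule inj_on_subset)
  have "coset_approximable G' B (K * (c * inverse \<epsilon>) powr N) \<epsilon>"
  proof (rule nat_groups[unfolded suitable_consts_iff, rule_format,
        OF \<phi>.G.is_group c B(1) _ _ _ _ \<epsilon>])
    show "finite B" using A(2) \<open>inj_on \<phi> B\<close> B(2) finite_image_iff by blast
    show "B \<noteq> {}" using A(3) B(2) by blast
    show "k_stable G' k B" using stable inj B by (intro \<phi>.k_stable_of_image) auto
    show "real (card (B <#>\<^bsub>G'\<^esub> set_inv\<^bsub>G'\<^esub> B <#>\<^bsub>G'\<^esub> B)) \<le> c * real (card B)"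
      using triple \<phi>.card_image_triple_product[OF inj B(1)] card_image[OF \<open>inj_on \<phi> B\<close>] B(2) by simp
  qed
  then show "coset_approximable G A (K * (c * inverse \<epsilon>) powr N) \<epsilon>"
    unfolding B(2) using inj B(1) by (rule \<phi>.coset_approximable_image)
qed

theorem theorem1p6:
  fixes k :: nat
  assumes "k \<ge> 1"
  shows "stable_K k > 0 \<and> stable_N k > 0 \<and>
    (\<forall>(G :: ('a, 'b) monoid_scheme) (c::real) A.
       group G \<longrightarrow> c \<ge> 1 \<longrightarrow> A \<subseteq> carrier G \<longrightarrow> finite A \<longrightarrow> A \<noteq> {} \<longrightarrow> k_stable G k A \<longrightarrow>
       real (card (A <#>\<^bsub>G\<^esub> set_inv\<^bsub>G\<^esub> A <#>\<^bsub>G\<^esub> A)) \<le> c * real (card A) \<longrightarrow>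
       (\<forall>\<epsilon>::real. 0 < \<epsilon> \<longrightarrow> \<epsilon> \<le> 1 / 2 \<longrightarrow>
          (\<exists>H. subgroup H G \<and> H \<subseteq> set_inv\<^bsub>G\<^esub> A <#>\<^bsub>G\<^esub> A \<and>
             (\<exists>C\<subseteq>A. A \<subseteq> C <#>\<^bsub>G\<^esub> H \<and>
                real (card C) \<le> stable_K k * (c * inverse \<epsilon>) powr stable_N k \<and>
                (\<exists>D\<subseteq>C. real (card (sym_diff A (D <#>\<^bsub>G\<^esub> H))) < \<epsilon> * real (card H))))))"
proof -
  let ?suitable = "\<lambda>(K, N). K > 0 \<and> N > 0 \<and> (\<forall>G :: nat monoid. group G \<longrightarrow> suitable_consts G k K N)"
  define n :: nat where "n = 2 ^ (2 ^ Suc k - 2)"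
  have "suitable_consts G k (2 * 4 ^ n) (real (n + 1))" if "group G" for G :: "nat monoid"
    unfolding n_def using that by (rule group.suitable_consts_explicit)
  then have "?suitable (2 * 4 ^ n, real (n + 1))" by simp
  then have "?suitable (stable_consts k)" unfolding stable_consts_def by (rule someI)
  then have constants: "stable_K k > 0" "stable_N k > 0"
      "\<And>G :: nat monoid. group G \<Longrightarrow> suitable_consts G k (stable_K k) (stable_N k)"
    by (auto simp: stable_K_def stable_N_def split: prod.splits)
  have suitable: "suitable_consts G k (stable_K k) (stable_N k)" if "group G"
    for G :: "('a, 'b) monoid_scheme"
    using constants(3) that by (rule suitable_consts_transfer)
  show ?thesis
    by (intro conjI allI impI constants(1,2))
      (rule suitable[unfolded suitable_consts_def, rule_format])
qed

end
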